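(* Let $n\ge1$, let $W=\mathfrak S_n$ be the symmetric group (the Coxeter group of type $A_{n-1}$, whose reflections are the transpositions), and fix the Coxeter element $c=(1\,2\,\cdots\,n)$. Then: (1) $c^{-1}$ has $n-1$ antiexceedances; (2) every element of $\mathfrak S_n$ other than $c^{-1}$ has at most $n-2$ antiexceedances; (3) for every $w\in\mathfrak S_n$, $\mathrm{aexc}(\mathsf{Pop}_T(w,c))=\mathrm{aexc}(w)-\mathrm{cyc}_{>1}(\pi_T(w,c))$.
   Context: An antiexceedance of $w\in\mathfrak S_n$ is an $i\in[n]$ with $i<w^{-1}(i)$; $\mathrm{aexc}(w)$ is the number of antiexceedances. $\mathrm{cyc}_{>1}(w)$ is the number of non-singleton cycles of $w$. $T$ is the set of transpositions; $\ell_T(w)$ is the minimal number of transpositions with product $w$; absolute order $v\le_T w$ iff $\ell_T(wv^{-1})=\ell_T(w)-\ell_T(v)$. $\mathrm{NC}(\mathfrak S_n,c)=[e,c]$ in absolute order, a lattice with join $\bigvee$. $\pi_T(w,c)=\bigvee_{t\in T,\ t\le_T w}t$ (join in $\mathrm{NC}(\mathfrak S_n,c)$, empty join $=e$) and $\mathsf{Pop}_T(w,c)=w\,\pi_T(w,c)^{-1}$. *)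

theory Defs
  imports
    "HOL-Combinatorics.Cycles"
    "HOL-Combinatorics.Orbits"
    "HOL-Algebra.Lattice"
begin

text \<open>
  Elements of the symmetric group on \<open>[n]\<close> are the functions \<open>w :: nat \<Rightarrow> nat\<close> with
  \<open>w permutes {1..n}\<close>; the group product is composition of functions.
\<close>

definition transpositions :: "nat \<Rightarrow> (nat \<Rightarrow> nat) set" where
  "transpositions n = {transpose i j | i j. 1 \<le> i \<and> i < j \<and> j \<le> n}"

definition refl_length :: "nat \<Rightarrow> (nat \<Rightarrow> nat) \<Rightarrow> nat" where
  "refl_length n w =
     (LEAST k. \<exists>ts. length ts = k \<and> set ts \<subseteq> transpositions n \<and> foldr (\<circ>) ts id = w)"

text \<open>The subtraction is carried out in the integers to avoid truncation.\<close>

definition abs_le :: "nat \<Rightarrow> (nat \<Rightarrow> nat) \<Rightarrow> (nat \<Rightarrow> nat) \<Rightarrow> bool" where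
  "abs_le n v w \<longleftrightarrow>
     int (refl_length n (w \<circ> inv v)) = int (refl_length n w) - int (refl_length n v)"

definition NC :: "nat \<Rightarrow> (nat \<Rightarrow> nat) \<Rightarrow> (nat \<Rightarrow> nat) gorder" where
  "NC n c = \<lparr> carrier = {u. u permutes {1..n} \<and> abs_le n id u \<and> abs_le n u c},
              eq = (=), le = abs_le n \<rparr>"

definition pi_T :: "nat \<Rightarrow> (nat \<Rightarrow> nat) \<Rightarrow> (nat \<Rightarrow> nat) \<Rightarrow> (nat \<Rightarrow> nat)" where
  "pi_T n w c = \<Squnion>\<^bsub>NC n c\<^esub> {t \<in> transpositions n. abs_le n t w}"

definition Pop_T :: "nat \<Rightarrow> (nat \<Rightarrow> nat) \<Rightarrow> (nat \<Rightarrow> nat) \<Rightarrow> (nat \<Rightarrow> nat)" where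
  "Pop_T n w c = w \<circ> inv (pi_T n w c)"

definition aexc :: "nat \<Rightarrow> (nat \<Rightarrow> nat) \<Rightarrow> nat" where
  "aexc n w = card {i \<in> {1..n}. i < inv w i}"

definition cyc_gt1 :: "nat \<Rightarrow> (nat \<Rightarrow> nat) \<Rightarrow> nat" where
  "cyc_gt1 n w = card {C \<in> orbit w ` {1..n}. card C > 1}"

text \<open>The cycle \<open>(1 2 \<dots> n)\<close>, sending \<open>i\<close> to \<open>i + 1\<close> for \<open>1 \<le> i < n\<close> and \<open>n\<close> to \<open>1\<close>.\<close>

definition long_cycle :: "nat \<Rightarrow> nat \<Rightarrow> nat" where
  "long_cycle n = cycle_of_list [1..<n + 1]"

end

theory Submission
  imports Defs
begin

text \<open>
  The elements of \<open>NC(S\<^sub>n, c)\<close> are the permutations \<open>p\<close> whose arcs \<open>x \<rightarrow> p x\<close>, drawn on a circle,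
  are not crossed by any cycle of \<open>p\<close>. Among these, \<open>p \<le>\<^sub>T u\<close> holds iff every cycle of \<open>p\<close> is
  contained in a cycle of \<open>u\<close>. Hence \<open>p = \<pi>\<^sub>T(w, c)\<close> runs cyclically, in increasing order, through the
  blocks of the finest noncrossing partition that is coarser than the cycles of \<open>w\<close>; a fixed point of
  \<open>w\<close> is a singleton block of it.

  The antiexceedances of \<open>w\<close> correspond to the \<open>j\<close> with \<open>w j < j\<close>, those of \<open>w p\<^sup>-\<^sup>1\<close> to the \<open>j\<close> with
  \<open>w j < p j\<close>. If \<open>j\<close> is not the maximum of its block, then \<open>p j\<close> is the next element of the block and
  both conditions agree. If \<open>j\<close> is the maximum of a block with more than one element, then \<open>p j\<close> is the
  minimum of the block, so \<open>w j < j\<close> holds and \<open>w j < p j\<close> fails: each nontrivial cycle of \<open>p\<close>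
  contributes exactly one to the difference.
\<close>

section \<open>Orbits and multiplication by a transposition\<close>

lemma orbit_eq_orbit:
  assumes "permutation w" "y \<in> orbit w x"
  shows "orbit w y = orbit w x"
  using assms cyclic_on_orbit' orbit_cyclic_eq3 by metis

lemma orbit_sym:
  assumes "permutation w" "y \<in> orbit w x"
  shows "x \<in> orbit w y"
  using assms orbit_swap permutation_self_in_orbit by metis

lemma orbit_apply_iff:
  assumes "permutation w"
  shows "w y \<in> orbit w x \<longleftrightarrow> y \<in> orbit w x"
  using assms orbit.step orbit.base orbit_sym orbit_trans by metis

lemma permutation_comp_transpose:
  "permutation w \<Longrightarrow> permutation (w \<circ> transpose a b)"
  by (simp add: permutation_compose permutation_swap_id)

lemma comp_transpose_twice: "w \<circ> transpose a b \<circ> transpose a b = w"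
  by (simp add: comp_assoc)

lemma orbit_eq_orbit_iff:
  assumes "permutation w"
  shows "orbit w y = orbit w x \<longleftrightarrow> y \<in> orbit w x"
  using assms orbit_eq_orbit permutation_self_in_orbit by metis

text \<open>A step of the product is a step of \<open>w\<close>, except that at \<open>a\<close> or
  \<open>b\<close> it goes to the image of the other point. So a walk leaves its
  \<open>w\<close>-orbit only by moving between the orbits of \<open>a\<close> and
  \<open>b\<close>.\<close>

lemma orbit_comp_transpose:
  assumes w: "permutation w" and z: "z \<in> orbit (w \<circ> transpose a b) x"
  shows "z \<in> orbit w x \<or> {x, z} \<subseteq> orbit w a \<union> orbit w b"
proof -
  \<comment> \<open>Phrased through equality of orbits, the relation is transitive, so single steps
    chain.\<close>
  let ?R = "\<lambda>x z. orbit w z = orbit w x \<or> {orbit w x, orbit w z} \<subseteq> {orbit w a, orbit w b}"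
  have step_y: "?R y ((w \<circ> transpose a b) y)" for y
    using permutation_orbit_step[OF w] by (simp add: transpose_def)
  from z have "?R x z"
  proof induction
    case base
    show ?case by (rule step_y)
  next
    case (step y)
    with step_y[of y] show ?case by (metis insert_subset)
  qed
  then show ?thesis by (simp add: orbit_eq_orbit_iff[OF w])
qed

text \<open>If \<open>b\<close> were never reached from \<open>a\<close>, the walk from
  \<open>a\<close> would enter the orbit of \<open>b\<close> at \<open>w b\<close> and then follow
  \<open>w\<close> along all of that orbit, which contains \<open>b\<close>.\<close>

lemma transpose_joins_orbits:
  assumes w: "permutation w" and ab: "b \<notin> orbit w a"
  shows "b \<in> orbit (w \<circ> transpose a b) a"
proof (rule ccontr)
  let ?w = "w \<circ> transpose a b"
  assume b: "b \<notin> orbit ?w a"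
  have a: "a \<notin> orbit w b" using ab orbit_sym[OF w] by blast
  have "z \<in> orbit ?w a \<and> z \<in> orbit w b" if "z \<in> orbit w b" for z
    using that
  proof induction
    case base
    have "?w a \<in> orbit ?w a" by (rule orbit.base)
    moreover have "?w a = w b" by simp
    ultimately show ?case using orbit.base by metis
  next
    case (step y)
    then have "y \<noteq> a" "y \<noteq> b" using a b by metis+
    then have "?w y = w y" by simp
    then show ?case using step by (metis orbit.step)
  qed
  then show False using b permutation_self_in_orbit[OF w] by blast
qed

lemma orbit_comp_transpose_eq:
  assumes w: "permutation w" and ab: "b \<notin> orbit w a"
  shows "orbit (w \<circ> transpose a b) x =
    (if x \<in> orbit w a \<union> orbit w b then orbit w a \<union> orbit w b else orbit w x)"
proof -
  let ?w = "w \<circ> transpose a b"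
  note w' = permutation_comp_transpose[OF w, of a b]
  note j = transpose_joins_orbits[OF w ab]
  note f = orbit_comp_transpose[OF w, of _ a b]
  \<comment> \<open>Multiplying the product by the same transposition again gives \<open>w\<close>,
    so \<open>orbit_comp_transpose\<close> also applies in this direction.\<close>
  have g: "z \<in> orbit ?w x" if "z \<in> orbit w x" for z x
    using orbit_comp_transpose[OF w', of z a b x] that orbit_eq_orbit[OF w' j]
    by (auto simp: comp_transpose_twice dest: orbit_sym[OF w'] intro: orbit_trans)
  show ?thesis
  proof (cases "x \<in> orbit w a \<union> orbit w b")
    case True
    then have "x \<in> orbit ?w a" using g orbit_eq_orbit[OF w' j] by blast
    then have "orbit ?w x = orbit ?w a" "orbit ?w x = orbit ?w b"
      using orbit_eq_orbit[OF w'] j by metis+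
    then have "orbit w a \<union> orbit w b \<subseteq> orbit ?w x" using g by blast
    moreover have "orbit ?w x \<subseteq> orbit w a \<union> orbit w b"
      using f True orbit_eq_orbit[OF w] by blast
    ultimately show ?thesis using True by auto
  next
    case False
    then show ?thesis using f g by auto
  qed
qed

lemma card_orbits_join:
  assumes w: "permutation w" and ab: "b \<notin> orbit w a" and S: "finite S" "a \<in> S" "b \<in> S"
  shows "card (orbit w ` S) = card (orbit (w \<circ> transpose a b) ` S) + 1"
proof -
  let ?A = "orbit w a" and ?B = "orbit w b" and ?O = "orbit w ` S"
  have self: "x \<in> orbit w x" for x by (rule permutation_self_in_orbit[OF w])
  have "?A \<noteq> ?B" using ab self by metis
  have cls: "x \<in> ?A \<union> ?B \<longleftrightarrow> orbit w x \<in> {?A, ?B}" for x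
    using orbit_eq_orbit[OF w] self by blast
  have "orbit (w \<circ> transpose a b) ` S = insert (?A \<union> ?B) (?O - {?A, ?B})"
    unfolding orbit_comp_transpose_eq[OF w ab] cls using S by (auto simp: image_iff)
  moreover have "?A \<union> ?B \<notin> ?O - {?A, ?B}"
    using cls self by (metis DiffE UnI1 imageE insertCI)
  ultimately have "card (orbit (w \<circ> transpose a b) ` S) = Suc (card (?O - {?A, ?B}))"
    using S by simp
  moreover have "card (?O - {?A, ?B}) = card ?O - 2"
    using S \<open>?A \<noteq> ?B\<close> by (subst card_Diff_subset) auto
  moreover have "card ?O \<ge> 2"
    using card_mono[of ?O "{?A, ?B}"] S \<open>?A \<noteq> ?B\<close> by simp
  ultimately show ?thesis by simp
qed

text \<open>Either the transposition merges two orbits, or \<open>w\<close> arises from the product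
  by such a merging, or \<open>a\<close> and \<open>b\<close> share an orbit before and after; in
  the last case no orbit changes.\<close>

lemma card_orbits_comp_transpose_le:
  assumes w: "permutation w" and S: "finite S" "a \<in> S" "b \<in> S"
  shows "card (orbit w ` S) \<le> card (orbit (w \<circ> transpose a b) ` S) + 1"
proof (cases "b \<in> orbit w a")
  case False
  then show ?thesis using card_orbits_join[OF w _ S] by simp
next
  case same: True
  let ?w = "w \<circ> transpose a b"
  note w' = permutation_comp_transpose[OF w, of a b]
  show ?thesis
  proof (cases "b \<in> orbit ?w a")
    case False
    then show ?thesis using card_orbits_join[OF w' False S] by (simp add: comp_transpose_twice)
  next
    case True
    have "z \<in> orbit ?w x" if "z \<in> orbit w x" for z x
      using orbit_comp_transpose[OF w', of z a b x] that orbit_eq_orbit[OF w' True]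
      by (auto simp: comp_transpose_twice dest: orbit_sym[OF w'] intro: orbit_trans)
    moreover have "z \<in> orbit w x" if "z \<in> orbit ?w x" for z x
      using orbit_comp_transpose[OF w that] orbit_eq_orbit[OF w same]
      by (auto dest: orbit_sym[OF w] intro: orbit_trans)
    ultimately have "orbit ?w = orbit w" by blast
    then show ?thesis by simp
  qed
qed

section \<open>Reflection length and absolute order\<close>

lemma transpositions_permutes: "t \<in> transpositions n \<Longrightarrow> t permutes {1..n}"
  by (auto simp: transpositions_def intro!: permutes_swap_id)

lemma transpose_in_transpositions:
  "a \<in> {1..n} \<Longrightarrow> b \<in> {1..n} \<Longrightarrow> a \<noteq> b \<Longrightarrow> transpose a b \<in> transpositions n"
  unfolding transpositions_def
  by (cases "a < b") (auto, metis transpose_commute le_neq_implies_less nat_le_linear)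

lemma permutes_interval_permutation: "w permutes {1..n::nat} \<Longrightarrow> permutation w"
  using permutation_permutes by blast

abbreviation transposition_word :: "nat \<Rightarrow> (nat \<Rightarrow> nat) list \<Rightarrow> (nat \<Rightarrow> nat) \<Rightarrow> bool" where
  "transposition_word n ts w \<equiv> set ts \<subseteq> transpositions n \<and> foldr (\<circ>) ts id = w"

lemma foldr_comp_Nil: "foldr (\<circ>) [] id = id"
  and foldr_comp_Cons: "foldr (\<circ>) (x # xs) id = x \<circ> foldr (\<circ>) xs id"
  by simp_all

lemma foldr_comp_append: "foldr (\<circ>) (xs @ ys) id = foldr (\<circ>) xs id \<circ> foldr (\<circ>) ys id"
  by (induction xs) (auto simp: comp_assoc)

lemma transposition_word_permutes: "set ts \<subseteq> transpositions n \<Longrightarrow> foldr (\<circ>) ts id permutes {1..n}"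
proof (induction ts)
  case Nil
  show ?case by (simp only: foldr_comp_Nil permutes_id)
next
  case (Cons t ts)
  have "foldr (\<circ>) ts id permutes {1..n}" by (rule Cons.IH) (use Cons.prems in auto)
  moreover have "t permutes {1..n}" by (rule transpositions_permutes) (use Cons.prems in auto)
  ultimately have "t \<circ> foldr (\<circ>) ts id permutes {1..n}" by (rule permutes_compose)
  then show ?case by (simp only: foldr_comp_Cons)
qed

lemma card_orbits_le:
  fixes w :: "nat \<Rightarrow> nat"
  shows "card (orbit w ` {1..n}) \<le> n"
  using card_image_le[of "{1..n}" "orbit w"] by simp

text \<open>Each letter costs at most one orbit. The arbitrary start \<open>v\<close> absorbs the
  letters in the induction; \<open>v = id\<close> gives the lower bound for the reflection
  length.\<close>

lemma card_orbits_transposition_word: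
  assumes "permutation v" "set ts \<subseteq> transpositions n"
  shows "card (orbit v ` {1..n}) \<le> card (orbit (v \<circ> foldr (\<circ>) ts id) ` {1..n}) + length ts"
  using assms
proof (induction ts arbitrary: v)
  case (Cons t ts)
  then obtain i j where t: "t = transpose i j" "i \<in> {1..n}" "j \<in> {1..n}"
    by (auto simp: transpositions_def)
  have "card (orbit v ` {1..n}) \<le> card (orbit (v \<circ> t) ` {1..n}) + 1"
    using card_orbits_comp_transpose_le[OF Cons.prems(1) _ t(2,3)] t by simp
  also have "\<dots> \<le> card (orbit (v \<circ> t \<circ> foldr (\<circ>) ts id) ` {1..n}) + length ts + 1"
    unfolding t(1) add_le_cancel_right
    by (rule Cons.IH[OF permutation_comp_transpose[OF Cons.prems(1)]]) (use Cons.prems(2) in auto)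
  finally show ?case by (simp only: foldr_comp_Cons comp_assoc list.size add.assoc One_nat_def)
qed simp

lemma orbits_id: "card (orbit id ` {1..n::nat}) = n"
proof -
  have "orbit id x = {x}" for x :: nat by (simp add: orbit_eq_singleton_iff)
  then show ?thesis by (simp add: card_image inj_on_def)
qed

text \<open>A suitable transposition splits a moved point off as a fixed point and gains one orbit;
  this is repeated until the identity is reached.\<close>

lemma ex_transposition_word:
  assumes "w permutes {1..n}"
  shows "\<exists>ts. length ts = n - card (orbit w ` {1..n}) \<and> transposition_word n ts w"
  using assms
proof (induction "n - card (orbit w ` {1..n})" arbitrary: w rule: less_induct)
  case less
  show ?case
  proof (cases "w = id")
    case True
    then show ?thesis by (intro exI[of _ "[]"]) (simp add: orbits_id del: One_nat_def)
  next
    case False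
    then obtain x where x: "w x \<noteq> x" by fastforce
    then have "x \<in> {1..n}" using less.prems permutes_not_in by metis
    have "x \<in> w ` {1..n}" using \<open>x \<in> {1..n}\<close> permutes_image[OF less.prems] by simp
    \<comment> \<open>As \<open>y\<close> is sent to \<open>x\<close>, multiplying by
      \<open>transpose y x\<close> makes \<open>x\<close> a fixed point.\<close>
    then obtain y where y: "w y = x" "y \<in> {1..n}" by auto
    note w = permutes_interval_permutation[OF less.prems]
    define t where "t = transpose y x"
    define v where "v = w \<circ> t"
    have t: "t \<in> transpositions n"
      unfolding t_def by (rule transpose_in_transpositions) (use x y \<open>x \<in> {1..n}\<close> in auto)
    have vt: "v \<circ> t = w" by (simp add: v_def t_def comp_transpose_twice)
    have v: "v permutes {1..n}"
      unfolding v_def by (rule permutes_compose[OF transpositions_permutes[OF t] less.prems])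
    have "v x = x" by (simp add: v_def t_def y)
    then have "orbit v x = {x}" by (simp add: orbit_eq_singleton_iff)
    moreover have "x \<noteq> y" using x y by auto
    ultimately have "x \<notin> orbit v y"
      using orbit_sym[OF permutes_interval_permutation[OF v], of x y] by auto
    from card_orbits_join[OF permutes_interval_permutation[OF v] this, of "{1..n}"]
    have c: "card (orbit v ` {1..n}) = card (orbit w ` {1..n}) + 1"
      using y \<open>x \<in> {1..n}\<close> vt by (simp add: t_def)
    \<comment> \<open>The bound \<open>card_orbits_le\<close> keeps the subtraction on naturals from
      truncating.\<close>
    have *: "n - card (orbit w ` {1..n}) = Suc (n - card (orbit v ` {1..n}))"
      using c card_orbits_le[of v n] by linarith
    then have "n - card (orbit v ` {1..n}) < n - card (orbit w ` {1..n})" by linarith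
    from less.hyps[OF this v] obtain ts
      where ts: "length ts = n - card (orbit v ` {1..n})" "transposition_word n ts v" by blast
    have "length (ts @ [t]) = n - card (orbit w ` {1..n})"
      unfolding * using ts(1) by simp
    moreover have "transposition_word n (ts @ [t]) w"
      using t ts(2) vt unfolding foldr_comp_append foldr_comp_Cons foldr_comp_Nil by simp
    ultimately show ?thesis by blast
  qed
qed

lemma refl_length_eq:
  assumes "w permutes {1..n}"
  shows "refl_length n w = n - card (orbit w ` {1..n})"
  unfolding refl_length_def
proof (rule Least_equality)
  show "\<exists>ts. length ts = n - card (orbit w ` {1..n}) \<and> transposition_word n ts w"
    by (rule ex_transposition_word[OF assms])
next
  fix k assume "\<exists>ts. length ts = k \<and> transposition_word n ts w"
  then show "n - card (orbit w ` {1..n}) \<le> k"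
    using card_orbits_transposition_word[of id _ n] by (fastforce simp: orbits_id simp del: One_nat_def)
qed

lemma refl_length_word:
  assumes "w permutes {1..n}"
  obtains ts where "length ts = refl_length n w" "transposition_word n ts w"
  using ex_transposition_word[OF assms] refl_length_eq[OF assms] by auto

lemma refl_length_le: "transposition_word n ts w \<Longrightarrow> refl_length n w \<le> length ts"
  unfolding refl_length_def by (rule Least_le) blast

lemma refl_length_comp:
  assumes "v permutes {1..n}" "w permutes {1..n}"
  shows "refl_length n (v \<circ> w) \<le> refl_length n v + refl_length n w"
proof -
  obtain xs where xs: "length xs = refl_length n v" "transposition_word n xs v"
    using refl_length_word assms by blast
  obtain ys where ys: "length ys = refl_length n w" "transposition_word n ys w"
    using refl_length_word assms by blast
  have "transposition_word n (xs @ ys) (v \<circ> w)"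
    using xs ys unfolding foldr_comp_append by simp
  from refl_length_le[OF this] show ?thesis using xs ys by simp
qed

lemma refl_length_id: "refl_length n id = 0"
  using refl_length_le[of "[]" n id] by simp

lemma refl_length_0:
  assumes "w permutes {1..n}" "refl_length n w = 0"
  shows "w = id"
  using refl_length_word[OF assms(1)] assms(2) by force

lemma refl_length_transposition:
  assumes "t \<in> transpositions n"
  shows "refl_length n t = 1"
proof -
  have "refl_length n t \<le> 1" using refl_length_le[of "[t]" n t] assms by simp
  moreover have "t \<noteq> id"
    using assms by (auto simp: transpositions_def) (metis id_apply less_irrefl transpose_apply_first)
  ultimately show ?thesis
    using refl_length_0[OF transpositions_permutes[OF assms]] by (cases "refl_length n t") auto
qed

lemma refl_length_comp_transposition:
  assumes w: "w permutes {1..n}" and ab: "a \<in> {1..n}" "b \<in> {1..n}" "b \<notin> orbit w a"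
  shows "refl_length n (w \<circ> transpose a b) = refl_length n w + 1"
proof -
  have "w \<circ> transpose a b permutes {1..n}"
    by (intro permutes_compose permutes_swap_id ab w)
  then show ?thesis
    using card_orbits_join[OF permutes_interval_permutation[OF w] ab(3), of "{1..n}"] ab
      card_orbits_le[of w n] w
    by (simp add: refl_length_eq)
qed

section \<open>Transpositions below a permutation, and antisymmetry\<close>

lemma abs_le_transposition:
  "abs_le n (transpose a b) w \<longleftrightarrow> refl_length n (w \<circ> transpose a b) + 1 = refl_length n w"
  if "transpose a b \<in> transpositions n"
  using refl_length_transposition[OF that] by (auto simp: abs_le_def)

text \<open>A transposition joining two different orbits lengthens \<open>w\<close> instead of
  shortening it.\<close>

lemma abs_le_transposition_imp_orbit:
  assumes "w permutes {1..n}" "a \<in> {1..n}" "b \<in> {1..n}" "transpose a b \<in> transpositions n"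
    and "abs_le n (transpose a b) w"
  shows "b \<in> orbit w a"
  using refl_length_comp_transposition[OF assms(1-3)] assms(5) abs_le_transposition[OF assms(4), of w]
  by fastforce

text \<open>The product with this transposition fixes \<open>w j\<close>, so multiplying back merges
  a fixed point into an orbit. These reflections link each moved point to its image, which is how
  upper bounds are later seen to contain the cycles of \<open>w\<close>.\<close>

lemma transposition_abs_le_apply:
  assumes w: "w permutes {1..n}" and j: "w j \<noteq> j"
  shows "transpose j (w j) \<in> transpositions n" "abs_le n (transpose j (w j)) w"
proof -
  have jn: "j \<in> {1..n}" "w j \<in> {1..n}"
    using j permutes_not_in[OF w] permutes_in_image[OF w] by metis+
  show t: "transpose j (w j) \<in> transpositions n"
    using transpose_in_transpositions jn j by metis
  let ?v = "w \<circ> transpose j (w j)"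
  have v: "?v permutes {1..n}" by (intro permutes_compose permutes_swap_id jn w)
  have "?v (w j) = w j" by simp
  then have "orbit ?v (w j) = {w j}" by (simp only: orbit_eq_singleton_iff)
  then have "w j \<notin> orbit ?v j"
    using orbit_sym[OF permutes_interval_permutation[OF v], of "w j" j] j by auto
  from refl_length_comp_transposition[OF v jn this]
  show "abs_le n (transpose j (w j)) w"
    by (simp add: abs_le_transposition[OF t] comp_transpose_twice)
qed

lemma abs_le_antisym:
  assumes u: "u permutes {1..n}" and v: "v permutes {1..n}"
    and "abs_le n u v" "abs_le n v u"
  shows "u = v"
proof -
  \<comment> \<open>The hypotheses make the lengths of \<open>v \<circ> inv u\<close> and
    \<open>u \<circ> inv v\<close> opposite integers, so both vanish.\<close>
  have "refl_length n (v \<circ> inv u) = 0" using assms(3,4) by (simp add: abs_le_def)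
  then have "v \<circ> inv u = id"
    using refl_length_0 permutes_compose permutes_inv u v by blast
  then have "v \<circ> inv u \<circ> u = u" by simp
  then show ?thesis using permutes_inv_o(2)[OF u] by (simp add: comp_assoc)
qed

section \<open>Noncrossing permutations\<close>

text \<open>
  \<open>gap x y\<close> is the open arc from \<open>x\<close> to \<open>y\<close> in the cyclic order of the natural numbers; for
  \<open>x = y\<close> it is everything except \<open>x\<close>.
\<close>

definition gap :: "nat \<Rightarrow> nat \<Rightarrow> nat \<Rightarrow> bool" where
  "gap x y z \<longleftrightarrow> (if x < y then x < z \<and> z < y else z < y \<or> x < z)"

text \<open>Since the ends of an arc lie outside it, the condition also keeps the rest of the cycle
  of \<open>x\<close> off the arc from \<open>x\<close> to \<open>v x\<close>: each cycle runs
  through its points in increasing cyclic order.\<close>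

definition noncrossing :: "(nat \<Rightarrow> nat) \<Rightarrow> bool" where
  "noncrossing v \<longleftrightarrow> (\<forall>x z. gap x (v x) (v z) \<longleftrightarrow> gap x (v x) z)"

lemma not_gap_ends: "\<not> gap x y x" "\<not> gap x y y"
  by (auto simp: gap_def)

lemma gap_rotate: "\<not> gap x y z \<Longrightarrow> z \<noteq> y \<Longrightarrow> gap x z y"
  by (auto simp: gap_def split: if_splits)

lemma gap_exchange: "\<not> gap x y z \<Longrightarrow> z \<noteq> x \<Longrightarrow> gap z y x"
  by (auto simp: gap_def split: if_splits)

lemma noncrossing_orbit:
  assumes "noncrossing v" "y \<in> orbit v z"
  shows "gap x (v x) y \<longleftrightarrow> gap x (v x) z"
  using assms(2) by induction (use assms(1) in \<open>auto simp: noncrossing_def\<close>)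

lemma noncrossing_orbit_not_gap:
  assumes "noncrossing v" "y \<in> orbit v x"
  shows "\<not> gap x (v x) y"
  using noncrossing_orbit[OF assms] not_gap_ends by blast

text \<open>The cyclic order is \<open>a\<close>, \<open>va\<close>, \<open>b\<close>,
  \<open>vb\<close>. The arc from \<open>a\<close> to \<open>vb\<close> consists of the two open
  arcs and the closed arc from \<open>va\<close> to \<open>b\<close>, which is the complement of
  \<open>gap b va\<close>.\<close>

lemma gap_decompose:
  assumes "a \<noteq> b" "va \<noteq> vb"
    and "\<not> gap a va b" "\<not> gap a va vb" "\<not> gap b vb a" "\<not> gap b vb va"
  shows "gap a vb z \<longleftrightarrow> gap a va z \<or> gap b vb z \<or> \<not> gap b va z"
  using assms unfolding gap_def by (auto split: if_splits)

text \<open>Here \<open>z\<close> lies on the arc from \<open>va\<close> up to \<open>b\<close>, and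
  \<open>y\<close> after \<open>b\<close> but not beyond \<open>a\<close>; going from
  \<open>z\<close> to \<open>y\<close> one passes \<open>b\<close> and not \<open>a\<close>.\<close>

lemma gap_separates:
  assumes "a \<noteq> b" "va \<noteq> vb"
    and "\<not> gap a va b" "\<not> gap a va vb" "\<not> gap b vb a" "\<not> gap b vb va"
    and "\<not> gap b va z" "z \<noteq> b" "gap b va y" "\<not> gap a va y"
  shows "gap z y b" "\<not> gap z y a"
  using assms unfolding gap_def by (auto split: if_splits)

text \<open>By \<open>gap_decompose\<close>, only the closed arcs from \<open>va\<close> to
  \<open>b\<close> and from \<open>vb\<close> to \<open>a\<close> need to be told apart. If
  \<open>y\<close> and \<open>z\<close> lay on different ones, the arc from \<open>z\<close> to
  \<open>y\<close> would separate \<open>a\<close> from \<open>b\<close>.\<close>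

lemma gap_split:
  assumes ab: "a \<noteq> b" "va \<noteq> vb"
      "\<not> gap a va b" "\<not> gap a va vb" "\<not> gap b vb a" "\<not> gap b vb va"
    and z: "z \<noteq> a" "z \<noteq> b"
    and y: "gap a va y \<longleftrightarrow> gap a va z" "gap b vb y \<longleftrightarrow> gap b vb z" "gap z y a \<longleftrightarrow> gap z y b"
  shows "gap a vb y \<longleftrightarrow> gap a vb z"
  using gap_decompose[OF ab] gap_separates[OF ab, of z y]
    gap_separates[of b a vb va z y] ab z y by metis

text \<open>The transposition cuts a cycle in two along a chord. Only the arcs starting at
  \<open>a\<close> and \<open>b\<close> are new.\<close>

lemma noncrossing_split:
  assumes v: "permutation v" and nc: "noncrossing v" and ab: "b \<in> orbit v a"
  shows "noncrossing (v \<circ> transpose a b)"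
proof (cases "a = b")
  case False
  have inj: "v x = v y \<longleftrightarrow> x = y" for x y
    using permutation_bijective[OF v] by (auto simp: bij_def inj_def)
  note o = noncrossing_orbit[OF nc] noncrossing_orbit_not_gap[OF nc]
  \<comment> \<open>Stated for fresh \<open>a\<close> and \<open>b\<close>, because the arc at
    \<open>b\<close> is the same claim with the roles exchanged.\<close>
  have at_a: "gap a (v b) ((v \<circ> transpose a b) z) \<longleftrightarrow> gap a (v b) z"
    if ne: "a \<noteq> b" and ab: "b \<in> orbit v a" for a b z
  proof -
    have ba: "a \<in> orbit v b" by (rule orbit_sym[OF v ab])
    note g = o(2)[OF ab] o(2)[OF orbit.step[OF ab]] o(2)[OF ba] o(2)[OF orbit.step[OF ba]]
    have vab: "v a \<noteq> v b" using ne inj by simp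
    consider "z = a" | "z = b" | "z \<noteq> a" "z \<noteq> b" by blast
    then show ?thesis
    proof cases
      case 1
      then show ?thesis by (simp add: not_gap_ends)
    next
      case 2
      have "gap a (v b) b" "gap a (v b) (v a)"
        using gap_exchange[OF g(3) ne] gap_rotate[OF g(2) vab[symmetric]] .
      with 2 show ?thesis by simp
    next
      case 3
      have "gap a (v b) (v z) \<longleftrightarrow> gap a (v b) z"
        using gap_split[OF ne vab g 3] o(1)[OF ab, of z] o(1)[OF orbit.base] by metis
      with 3 show ?thesis by simp
    qed
  qed
  show ?thesis unfolding noncrossing_def
  proof (intro allI)
    fix x z
    let ?v = "v \<circ> transpose a b"
    consider "x = a" | "x = b" | "x \<noteq> a" "x \<noteq> b" by blast
    then show "gap x (?v x) (?v z) \<longleftrightarrow> gap x (?v x) z"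
    proof cases
      case 1
      then show ?thesis using at_a[OF False ab, of z] by simp
    next
      case 2
      then show ?thesis using at_a[of b a z] False orbit_sym[OF v ab]
        by (simp add: transpose_commute)
    next
      case 3
      have "gap x (v x) (v (transpose a b z)) \<longleftrightarrow> gap x (v x) (transpose a b z)"
        using nc by (simp add: noncrossing_def)
      \<comment> \<open>The points \<open>a\<close> and \<open>b\<close> lie in one cycle, hence on
        the same side of the old arc.\<close>
      also have "\<dots> \<longleftrightarrow> gap x (v x) z"
        using o(1)[OF ab, of x] by (auto simp: transpose_def)
      finally show ?thesis using 3 by simp
    qed
  qed
qed (use nc in simp)

lemma noncrossing_transpose: "a < b \<Longrightarrow> noncrossing (transpose a b)"
  unfolding noncrossing_def gap_def transpose_def by auto

text \<open>This is the usual four-point form of noncrossing for the orbits.\<close>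

lemma noncrossing_orbits_4:
  assumes v: "permutation v" and nc: "noncrossing v"
    and lt: "a < b" "b < c" "c < d" and ac: "c \<in> orbit v a" and bd: "d \<in> orbit v b"
  shows "b \<in> orbit v a"
proof (rule ccontr)
  assume nb: "b \<notin> orbit v a"
  let ?Z = "{z \<in> orbit v a. z \<le> b}"
  \<comment> \<open>The last point of the orbit of \<open>a\<close> before \<open>b\<close>: its arc
    jumps over \<open>b\<close> and ends no later than \<open>c\<close>, so it separates
    \<open>b\<close> from \<open>d\<close>.\<close>
  define m where "m = Max ?Z"
  have fin: "finite ?Z" by (rule finite_subset[of _ "{..b}"]) auto
  moreover have "a \<in> ?Z" using permutation_self_in_orbit[OF v] lt by auto
  ultimately have "m \<in> ?Z" unfolding m_def by (intro Max_in) auto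
  then have m: "m \<in> orbit v a" "m < b" using nb by (auto simp: le_less)
  have "v m \<in> orbit v a" using m orbit.step by metis
  have c: "\<not> gap m (v m) c"
    using noncrossing_orbit[OF nc ac] noncrossing_orbit[OF nc m(1)] not_gap_ends by metis
  have "v m \<le> m \<or> b < v m"
    using Max_ge[OF fin, of "v m"] \<open>v m \<in> orbit v a\<close> by (auto simp: m_def)
  then have "gap m (v m) b \<and> \<not> gap m (v m) d"
    using c lt m by (auto simp: gap_def split: if_splits)
  then show False using noncrossing_orbit[OF nc bd] by blast
qed

section \<open>The noncrossing permutation of a noncrossing equivalence relation\<close>

definition cyclic_succ :: "(nat \<Rightarrow> nat \<Rightarrow> bool) \<Rightarrow> nat \<Rightarrow> nat" where
  "cyclic_succ E x = (if \<exists>y>x. E x y then LEAST y. y > x \<and> E x y else LEAST y. E x y)"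

text \<open>The relation lives on all of \<open>nat\<close>, like the permutations;
  \<open>E_range\<close> makes each point outside \<open>{1..n}\<close> a class of its own, so that
  \<open>cyclic_succ E\<close> fixes it.\<close>

locale noncrossing_equiv =
  fixes n :: nat and E :: "nat \<Rightarrow> nat \<Rightarrow> bool"
  assumes E_refl: "E x x"
    and E_sym: "E x y \<Longrightarrow> E y x"
    and E_trans: "E x y \<Longrightarrow> E y z \<Longrightarrow> E x z"
    and E_range: "E x y \<Longrightarrow> x \<noteq> y \<Longrightarrow> y \<in> {1..n}"
    and E_noncrossing: "a < b \<Longrightarrow> b < c \<Longrightarrow> c < d \<Longrightarrow> E a c \<Longrightarrow> E b d \<Longrightarrow> E a b"
begin

lemma E_cyclic_succ: "E x (cyclic_succ E x)"
proof (cases "\<exists>y>x. E x y")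
  case True
  then show ?thesis using LeastI_ex[of "\<lambda>y. y > x \<and> E x y"] by (auto simp: cyclic_succ_def)
next
  case False
  then show ?thesis using LeastI[of "E x", OF E_refl] by (auto simp: cyclic_succ_def)
qed

lemma cyclic_succ_not_gap:
  assumes "E x y"
  shows "\<not> gap x (cyclic_succ E x) y"
proof (cases "\<exists>y>x. E x y")
  case True
  then show ?thesis
    using LeastI_ex[of "\<lambda>y. y > x \<and> E x y"] Least_le[of "\<lambda>y. y > x \<and> E x y" y] assms
    by (auto simp: cyclic_succ_def gap_def)
next
  case False
  then show ?thesis
    using Least_le[of "E x" y] Least_le[of "E x" x] assms E_refl by (auto simp: cyclic_succ_def gap_def)
qed

lemma gap_E:
  assumes "E z z'" "gap x (cyclic_succ E x) z"
  shows "gap x (cyclic_succ E x) z'"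
proof (rule ccontr)
  let ?s = "cyclic_succ E x"
  assume n: "\<not> gap x ?s z'"
  have nz: "\<not> E x z" using cyclic_succ_not_gap assms(2) by blast
  then have ne: "z' \<noteq> x" "z' \<noteq> ?s" "z \<noteq> x" "z \<noteq> ?s"
    using assms(1) E_cyclic_succ E_sym E_trans E_refl by blast+
  have no: "\<not> E z x" "\<not> E ?s z" "\<not> E x z'" "\<not> E z' x" "\<not> E z ?s" "\<not> E z' ?s" "\<not> E ?s z'"
    using nz assms(1) E_cyclic_succ E_sym E_trans by blast+
  have E: "E x ?s" "E ?s x" "E z z'" "E z' z" using E_cyclic_succ E_sym assms(1) by blast+
  \<comment> \<open>The first two cases have \<open>x < ?s\<close>, the last two have an arc that
    wraps around. In each, the pairs \<open>x, ?s\<close> and \<open>z, z'\<close>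
    alternate.\<close>
  consider "x < ?s" "x < z" "z < ?s" "z' < x" | "x < ?s" "x < z" "z < ?s" "?s < z'"
    | "?s < z'" "z' < x" "z < ?s" | "?s < z'" "z' < x" "x < z"
    using assms(2) n ne by (auto simp: gap_def split: if_splits)
  then show False
  proof cases
    case 1
    then show False using E_noncrossing[of z' x z ?s] E no by blast
  next
    case 2
    then show False using E_noncrossing[of x z ?s z'] E nz by blast
  next
    case 3
    then show False using E_noncrossing[of z ?s z' x] E no by blast
  next
    case 4
    then show False using E_noncrossing[of ?s z' x z] E no by blast
  qed
qed

lemma noncrossing_cyclic_succ: "noncrossing (cyclic_succ E)"
  unfolding noncrossing_def using gap_E E_cyclic_succ E_sym by blast

lemma cyclic_succ_permutes: "cyclic_succ E permutes {1..n}"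
proof -
  have inj: "inj (cyclic_succ E)"
  proof (rule linorder_injI)
    fix x y :: nat assume "x < y"
    show "cyclic_succ E x \<noteq> cyclic_succ E y"
    proof
      assume eq: "cyclic_succ E x = cyclic_succ E y"
      then have "E x y" using E_cyclic_succ E_sym E_trans by metis
      \<comment> \<open>With a common endpoint, the longer of the two arcs would contain the
        starting point of the other.\<close>
      then have "\<not> gap x (cyclic_succ E x) y" "\<not> gap y (cyclic_succ E x) x"
        using cyclic_succ_not_gap E_sym eq by metis+
      then show False using \<open>x < y\<close> by (auto simp: gap_def split: if_splits)
    qed
  qed
  have "cyclic_succ E x \<in> {1..n}" if "x \<in> {1..n}" for x
    using E_range[OF E_cyclic_succ, of x] that by metis
  then have "cyclic_succ E ` {1..n} \<subseteq> {1..n}" by (rule image_subsetI)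
  then have "cyclic_succ E ` {1..n} = {1..n}"
    using endo_inj_surj[of "{1..n}" "cyclic_succ E"] inj inj_on_subset by blast
  then have "bij_betw (cyclic_succ E) {1..n} {1..n}"
    using inj_on_subset[OF inj subset_UNIV] unfolding bij_betw_def by blast
  then show ?thesis
    by (rule bij_imp_permutes) (use E_range E_cyclic_succ E_sym in metis)
qed

lemma orbit_cyclic_succ: "y \<in> orbit (cyclic_succ E) x \<longleftrightarrow> E x y"
proof
  assume "y \<in> orbit (cyclic_succ E) x"
  then show "E x y" by induction (use E_cyclic_succ E_trans in blast)+
next
  assume xy: "E x y"
  let ?s = "cyclic_succ E" let ?O = "orbit ?s x"
  have s: "permutation ?s" by (rule permutes_interval_permutation[OF cyclic_succ_permutes])
  have self: "x \<in> ?O" by (rule permutation_self_in_orbit[OF s])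
  have fin: "finite ?O" by (rule finite_orbit[OF self])
  have OE: "E x z" if "z \<in> ?O" for z
    using that by induction (use E_cyclic_succ E_trans in blast)+
  show "y \<in> ?O"
  proof (rule ccontr)
    assume ny: "y \<notin> ?O"
    \<comment> \<open>The maximum of \<open>Z\<close> is the last orbit point before
      \<open>y\<close> in cyclic order. Its successor is again in the orbit, so its arc passes over
      \<open>y\<close>, although no arc contains a point of its own class.\<close>
    define Z where "Z = (if \<exists>z\<in>?O. z < y then {z \<in> ?O. z < y} else ?O)"
    have Z: "finite Z" "Z \<noteq> {}" "Z \<subseteq> ?O" using fin self by (auto simp: Z_def)
    define m where "m = Max Z"
    have m: "m \<in> Z" "m \<in> ?O" using Max_in Z unfolding m_def by blast+
    have sm: "?s m \<in> ?O" using orbit.step[OF m(2)] .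
    have "E m y" using OE m xy E_sym E_trans by blast
    then have "\<not> gap m (?s m) y" by (rule cyclic_succ_not_gap)
    moreover have "?s m \<le> m" if "?s m \<in> Z" using Max_ge[OF Z(1) that] by (simp add: m_def)
    ultimately show False
      using m sm ny by (auto simp: Z_def gap_def split: if_splits) (metis linorder_neqE_nat less_le_trans not_le)+
  qed
qed

end

section \<open>Absolute order on noncrossing permutations\<close>

text \<open>Turns left multiplication by a transposition into right multiplication, the form in
  which orbits and lengths are controlled.\<close>

lemma comp_transpose_conj:
  assumes "bij v"
  shows "transpose a b \<circ> v = v \<circ> transpose (inv v a) (inv v b)"
proof -
  have "x = inv v y \<longleftrightarrow> v x = y" "v (inv v y) = y" for x y
    using bij_inv_eq_iff[OF assms] bij_is_surj[OF assms] by (auto simp: surj_f_inv_f)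
  then show ?thesis by (auto simp: fun_eq_iff transpose_def)
qed

text \<open>The length bound forces each letter peeled off \<open>v\<close> to shorten it, hence to
  cut a cycle, and cutting preserves noncrossing.\<close>

lemma noncrossing_of_word:
  assumes "noncrossing v" "v permutes {1..n}" "u permutes {1..n}" "set ts \<subseteq> transpositions n"
    and "v = foldr (\<circ>) ts id \<circ> u" "length ts + refl_length n u \<le> refl_length n v"
  shows "noncrossing u"
  using assms
proof (induction ts arbitrary: v)
  case Nil
  then show ?case by simp
next
  case (Cons t ts)
  define r where "r = foldr (\<circ>) ts id \<circ> u"
  obtain i j where t: "t = transpose i j" "i \<in> {1..n}" "j \<in> {1..n}"
    using Cons.prems by (auto simp: transpositions_def)
  have tn: "t \<in> transpositions n" "set ts \<subseteq> transpositions n" using Cons.prems(4) by auto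
  have w: "foldr (\<circ>) ts id permutes {1..n}"
    by (rule transposition_word_permutes[OF tn(2)])
  then have r: "r permutes {1..n}" unfolding r_def by (rule permutes_compose[OF Cons.prems(3)])
  have vr: "v = t \<circ> r" unfolding Cons.prems(5) r_def foldr_comp_Cons by (rule comp_assoc)
  have "refl_length n r \<le> length ts + refl_length n u"
    unfolding r_def
    using refl_length_comp[OF w Cons.prems(3)] refl_length_le[OF conjI[OF tn(2) refl]]
    by linarith
  then have lt: "refl_length n r < refl_length n v" using Cons.prems(6) by simp
  have "refl_length n v \<le> 1 + refl_length n r"
    unfolding vr using refl_length_comp[OF transpositions_permutes[OF tn(1)] r]
    by (simp add: refl_length_transposition[OF tn(1)])
  then have le: "length ts + refl_length n u \<le> refl_length n r" using Cons.prems(6) by simp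
  let ?i = "inv v i" and ?j = "inv v j"
  have inv: "?i \<in> {1..n}" "?j \<in> {1..n}"
    using t permutes_in_image[OF permutes_inv[OF Cons.prems(2)]] by blast+
  have "r = t \<circ> v" unfolding vr t(1) by (simp add: comp_assoc[symmetric])
  then have rv: "r = v \<circ> transpose ?i ?j"
    unfolding t(1) by (simp only: comp_transpose_conj[OF permutes_bij[OF Cons.prems(2)]])
  \<comment> \<open>In different orbits of \<open>v\<close>, these points would make
    \<open>r\<close> longer than \<open>v\<close>.\<close>
  have "?j \<in> orbit v ?i"
    using refl_length_comp_transposition[OF Cons.prems(2) inv] lt rv by fastforce
  then have "noncrossing r"
    unfolding rv
    by (rule noncrossing_split[OF permutes_interval_permutation[OF Cons.prems(2)] Cons.prems(1)])
  then show ?case by (rule Cons.IH[OF _ r Cons.prems(3) tn(2) r_def le])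
qed

lemma noncrossing_below:
  assumes "noncrossing v" "v permutes {1..n}" "u permutes {1..n}" "abs_le n u v"
  shows "noncrossing u"
proof -
  have "v \<circ> inv u permutes {1..n}" by (intro permutes_compose permutes_inv assms)
  then obtain ts where ts: "length ts = refl_length n (v \<circ> inv u)"
    "transposition_word n ts (v \<circ> inv u)" using refl_length_word by blast
  have "v = foldr (\<circ>) ts id \<circ> u"
    using ts permutes_inv_o(2)[OF assms(3)] by (simp add: comp_assoc)
  moreover have "length ts + refl_length n u \<le> refl_length n v"
    using assms(4) ts(1) by (simp add: abs_le_def)
  ultimately show ?thesis using noncrossing_of_word[OF assms(1-3)] ts(2) by blast
qed

text \<open>
  If \<open>p\<close> and \<open>u\<close> disagree at \<open>x\<close>, cutting the cycle of \<open>u\<close> along the arc from \<open>x\<close> to \<open>p x\<close>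
  gives a noncrossing permutation which still contains the cycles of \<open>p\<close> and agrees with \<open>p\<close>
  at one more point.
\<close>

lemma refl_length_refines:
  assumes p: "p permutes {1..n}" "noncrossing p"
    and "u permutes {1..n}" "noncrossing u" "\<And>x. p x \<in> orbit u x"
  shows "refl_length n (u \<circ> inv p) + refl_length n p \<le> refl_length n u"
  using assms(3-5)
proof (induction "card {x \<in> {1..n}. p x \<noteq> u x}" arbitrary: u rule: less_induct)
  case less
  note u = less.prems
  show ?case
  proof (cases "u = p")
    case True
    then show ?thesis using permutes_inv_o(1)[OF p(1)] refl_length_id by simp
  next
    case False
    then obtain x where x: "p x \<noteq> u x" by fastforce
    then have xn: "x \<in> {1..n}" using permutes_not_in[OF p(1)] permutes_not_in[OF u(1)] by metis
    define y where "y = p x"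
    \<comment> \<open>With \<open>u b = y\<close>, the product of \<open>u\<close> and
      \<open>transpose x b\<close> sends \<open>x\<close> to \<open>y = p x\<close>.\<close>
    define b where "b = inv u y"
    have ub: "u b = y" unfolding b_def by (simp add: permutes_inverses(1)[OF u(1)])
    have ne: "x \<noteq> b" "y \<noteq> u x" using x ub y_def by auto
    have yn: "y \<in> {1..n}" unfolding y_def using permutes_in_image[OF p(1)] xn by blast
    then have bn: "b \<in> {1..n}" unfolding b_def using permutes_in_image[OF permutes_inv[OF u(1)]] by blast
    note pu = permutes_interval_permutation[OF u(1)]
    have yo: "y \<in> orbit u x" unfolding y_def by (rule u(3))
    have bo: "b \<in> orbit u x" using yo orbit_apply_iff[OF pu] ub by metis
    define t where "t = transpose x b"
    have t: "t \<in> transpositions n" unfolding t_def by (rule transpose_in_transpositions[OF xn bn ne(1)])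
    define v where "v = u \<circ> t"
    have v: "v permutes {1..n}"
      unfolding v_def by (rule permutes_compose[OF transpositions_permutes[OF t] u(1)])
    note pv = permutes_interval_permutation[OF v]
    have nv: "noncrossing v" unfolding v_def t_def by (rule noncrossing_split[OF pu u(2) bo])
    have uv: "u = v \<circ> t" by (simp add: v_def t_def comp_transpose_twice)
    have vx: "v x = y" and vb: "v b = u x" and vz: "z \<noteq> x \<Longrightarrow> z \<noteq> b \<Longrightarrow> v z = u z" for z
      by (simp_all add: v_def t_def ub)
    \<comment> \<open>No point of the cycle of \<open>u\<close> lies between \<open>x\<close> and
      \<open>u x\<close>, so \<open>u x\<close> is inside the arc from \<open>x\<close> to
      \<open>y\<close>. This is an arc of \<open>v\<close>, so it separates the
      \<open>v\<close>-orbits of \<open>x\<close> and \<open>b\<close>.\<close>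
    have "gap x y (u x)"
      by (rule gap_rotate[OF noncrossing_orbit_not_gap[OF u(2) yo] ne(2)])
    then have gb: "gap x y b" using nv vx vb unfolding noncrossing_def by metis
    have orb_x: "\<not> gap x y z" if "z \<in> orbit v x" for z
      using noncrossing_orbit_not_gap[OF nv that] vx by simp
    have orb_b: "gap x y z" if "z \<in> orbit v b" for z
      using noncrossing_orbit[OF nv that, of x] vx gb by simp
    have "b \<notin> orbit v x" using orb_x gb by blast
    then have len: "refl_length n u = refl_length n v + 1"
      using refl_length_comp_transposition[OF v xn bn] uv t_def by metis
    have sub: "p z \<in> orbit v z" for z
    proof -
      have "p z \<in> orbit (v \<circ> transpose x b) z" using u(3) uv t_def by metis
      then have "p z \<in> orbit v z \<or> {z, p z} \<subseteq> orbit v x \<union> orbit v b"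
        by (rule orbit_comp_transpose[OF pv])
      \<comment> \<open>The same arc belongs to \<open>p\<close>, so no cycle of \<open>p\<close> is
        torn apart by the cut.\<close>
      moreover have "gap x y (p z) \<longleftrightarrow> gap x y z"
        using p(2) unfolding noncrossing_def y_def by blast
      ultimately show ?thesis
        using orb_x orb_b orbit_eq_orbit[OF pv] by (metis UnE insert_subset)
    qed
    have "card {z \<in> {1..n}. p z \<noteq> v z} < card {z \<in> {1..n}. p z \<noteq> u z}"
    proof (rule psubset_card_mono)
      \<comment> \<open>At \<open>b\<close> there was a disagreement already:
        \<open>u b = p x\<close>, which differs from \<open>p b\<close>.\<close>
      have "p z \<noteq> u z" if "p z \<noteq> v z" for z
        using that x vx vz ub y_def permutes_inj[OF p(1)] unfolding inj_def by metis
      moreover have "p x = v x" using vx y_def by simp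
      ultimately show "{z \<in> {1..n}. p z \<noteq> v z} \<subset> {z \<in> {1..n}. p z \<noteq> u z}"
        using xn x by blast
    qed simp
    from less.hyps[OF this v nv sub]
    have IH: "refl_length n (v \<circ> inv p) + refl_length n p \<le> refl_length n v" .
    have "bij (inv p)" using permutes_bij[OF permutes_inv[OF p(1)]] .
    then have "t \<circ> inv p = inv p \<circ> transpose (p x) (p b)"
      unfolding t_def comp_transpose_conj[OF \<open>bij (inv p)\<close>] by (simp add: inv_inv_eq permutes_bij[OF p(1)])
    then have "u \<circ> inv p = (v \<circ> inv p) \<circ> transpose (p x) (p b)"
      unfolding uv by (simp add: comp_assoc)
    moreover have "transpose (p x) (p b) \<in> transpositions n"
      using xn bn ne(1) permutes_in_image[OF p(1)] permutes_inj[OF p(1)]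
      by (intro transpose_in_transpositions) (auto dest: injD)
    ultimately have "refl_length n (u \<circ> inv p) \<le> refl_length n (v \<circ> inv p) + 1"
      using refl_length_comp[OF permutes_compose[OF permutes_inv[OF p(1)] v]]
        transpositions_permutes refl_length_transposition by metis
    then show ?thesis using IH len by simp
  qed
qed

text \<open>Subadditivity of the length supplies the inequality opposite to
  \<open>refl_length_refines\<close>.\<close>

lemma abs_le_refines:
  assumes "p permutes {1..n}" "noncrossing p" "u permutes {1..n}" "noncrossing u"
    and "\<And>x. p x \<in> orbit u x"
  shows "abs_le n p u"
proof -
  have "u \<circ> inv p \<circ> p = u" using permutes_inv_o(2)[OF assms(1)] by (simp add: comp_assoc)
  then have "refl_length n u \<le> refl_length n (u \<circ> inv p) + refl_length n p"
    using refl_length_comp[OF permutes_compose[OF permutes_inv[OF assms(1)] assms(3)] assms(1)] by simp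
  then show ?thesis using refl_length_refines[OF assms] by (simp add: abs_le_def)
qed

lemma transposition_abs_le_iff:
  assumes u: "u permutes {1..n}" "noncrossing u" and ij: "1 \<le> i" "i < j" "j \<le> n"
  shows "abs_le n (transpose i j) u \<longleftrightarrow> j \<in> orbit u i"
proof
  note pu = permutes_interval_permutation[OF u(1)]
  assume j: "j \<in> orbit u i"
  have "transpose i j x \<in> orbit u x" for x
    using j orbit_sym[OF pu j] permutation_self_in_orbit[OF pu] by (auto simp: transpose_def)
  then show "abs_le n (transpose i j) u"
    using ij by (intro abs_le_refines u noncrossing_transpose permutes_swap_id) auto
next
  assume "abs_le n (transpose i j) u"
  then show "j \<in> orbit u i"
    using ij by (intro abs_le_transposition_imp_orbit[OF u(1)] transpose_in_transpositions) auto
qed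

section \<open>The long cycle\<close>

lemma long_cycle_apply:
  assumes "n \<ge> 1"
  shows "long_cycle n i = (if 1 \<le> i \<and> i < n then i + 1 else if i = n then 1 else i)"
proof (cases "i \<in> {1..n}")
  case True
  let ?cs = "[1..<n + 1]"
  have "map (long_cycle n) ?cs = rotate1 ?cs"
    using cyclic_rotation[of ?cs 1] by (simp add: long_cycle_def)
  then have "map (long_cycle n) ?cs ! (i - 1) = rotate1 ?cs ! (i - 1)" by simp
  moreover have "map (long_cycle n) ?cs ! (i - 1) = long_cycle n i"
    using True by (subst nth_map) (auto simp del: upt_Suc)
  \<comment> \<open>List positions start at 0, so \<open>i\<close> sits at position
    \<open>i - 1\<close>; \<open>i mod n\<close> produces the wrap from \<open>n\<close> to
    1.\<close>
  moreover have "rotate1 ?cs ! (i - 1) = 1 + i mod n"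
    using True by (subst nth_rotate1) (auto simp del: upt_Suc)
  ultimately show ?thesis using True by auto
next
  case False
  then have "long_cycle n i = i" unfolding long_cycle_def by (intro id_outside_supp) auto
  then show ?thesis using False assms by auto
qed

lemma long_cycle_permutes: "long_cycle n permutes {1..n}"
proof -
  have "set [1..<n + 1] = {1..n}" by auto
  then show ?thesis using cycle_permutes[of "[1..<n + 1]"] by (simp only: long_cycle_def)
qed

lemma noncrossing_long_cycle: "n \<ge> 1 \<Longrightarrow> noncrossing (long_cycle n)"
  unfolding noncrossing_def gap_def by (auto simp: long_cycle_apply)

lemma orbit_long_cycle:
  assumes "n \<ge> 1" "x \<in> {1..n}" "y \<in> {1..n}"
  shows "y \<in> orbit (long_cycle n) x"
proof -
  have p: "permutation (long_cycle n)"
    by (rule permutes_interval_permutation[OF long_cycle_permutes])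
  have "k + 1 \<in> orbit (long_cycle n) 1" if "k + 1 \<le> n" for k
    using that
  proof (induction k)
    case 0
    then show ?case using permutation_self_in_orbit[OF p] by simp
  next
    case (Suc k)
    then have "long_cycle n (k + 1) \<in> orbit (long_cycle n) 1" by (intro orbit.step) simp
    moreover have "long_cycle n (k + 1) = Suc k + 1"
      using Suc.prems by (simp add: long_cycle_apply[OF assms(1)])
    ultimately show ?case by (simp only:)
  qed
  from this[of "x - 1"] this[of "y - 1"]
  have "x \<in> orbit (long_cycle n) 1" "y \<in> orbit (long_cycle n) 1" using assms by auto
  then show ?thesis using orbit_eq_orbit[OF p] by metis
qed

lemma orbit_long_cycle_refines:
  assumes "n \<ge> 1" "u permutes {1..n}"
  shows "u x \<in> orbit (long_cycle n) x"
proof (cases "x \<in> {1..n}")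
  case True
  then show ?thesis using orbit_long_cycle[OF assms(1)] permutes_in_image[OF assms(2)] by blast
next
  case False
  then have "u x = x" by (rule permutes_not_in[OF assms(2)])
  then show ?thesis
    using permutation_self_in_orbit[OF permutes_interval_permutation[OF long_cycle_permutes]] by simp
qed

text \<open>The long cycle is noncrossing, and so is everything below it. Conversely it has a single
  orbit on \<open>{1..n}\<close>, so every noncrossing \<open>u\<close> refines it.\<close>

lemma NC_carrier_iff:
  assumes "n \<ge> 1"
  shows "u \<in> carrier (NC n (long_cycle n)) \<longleftrightarrow> u permutes {1..n} \<and> noncrossing u"
proof -
  note c = long_cycle_permutes[of n] noncrossing_long_cycle[OF assms]
  have "abs_le n u (long_cycle n)" if "u permutes {1..n}" "noncrossing u"
    by (rule abs_le_refines[OF that c]) (rule orbit_long_cycle_refines[OF assms that(1)])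
  moreover have "abs_le n id u" by (simp add: abs_le_def refl_length_id inv_id)
  ultimately show ?thesis
    using noncrossing_below[OF c(2,1)] by (auto simp: NC_def)
qed

section \<open>The join of the reflections below a permutation\<close>

definition noncrossing_above :: "nat \<Rightarrow> (nat \<Rightarrow> nat) \<Rightarrow> (nat \<Rightarrow> nat) set" where
  "noncrossing_above n w = {u. u permutes {1..n} \<and> noncrossing u \<and> (\<forall>x. w x \<in> orbit u x)}"

text \<open>The finest noncrossing partition whose blocks are unions of cycles of
  \<open>w\<close>.\<close>

definition noncrossing_rel :: "nat \<Rightarrow> (nat \<Rightarrow> nat) \<Rightarrow> nat \<Rightarrow> nat \<Rightarrow> bool" where
  "noncrossing_rel n w x y \<longleftrightarrow> (\<forall>u\<in>noncrossing_above n w. y \<in> orbit u x)"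

definition noncrossing_closure :: "nat \<Rightarrow> (nat \<Rightarrow> nat) \<Rightarrow> nat \<Rightarrow> nat" where
  "noncrossing_closure n w = cyclic_succ (noncrossing_rel n w)"

lemma noncrossing_aboveD:
  assumes "u \<in> noncrossing_above n w"
  shows "u permutes {1..n}" "noncrossing u" "w x \<in> orbit u x" "permutation u"
  using assms permutes_interval_permutation by (auto simp: noncrossing_above_def)

lemma noncrossing_above_orbit:
  assumes "u \<in> noncrossing_above n w" "y \<in> orbit w x"
  shows "y \<in> orbit u x"
  using assms(2) by induction (blast intro: noncrossing_aboveD(3)[OF assms(1)] orbit_trans)+

lemma noncrossing_equiv_rel:
  assumes n: "n \<ge> 1" and w: "w permutes {1..n}"
  shows "noncrossing_equiv n (noncrossing_rel n w)"
proof
  note D = noncrossing_aboveD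
  fix x y z
  show "noncrossing_rel n w x x"
    using permutation_self_in_orbit[OF D(4)] by (auto simp: noncrossing_rel_def)
  show "noncrossing_rel n w y x" if "noncrossing_rel n w x y"
    using that orbit_sym[OF D(4)] by (auto simp: noncrossing_rel_def)
  show "noncrossing_rel n w x z" if "noncrossing_rel n w x y" "noncrossing_rel n w y z"
    using that orbit_trans unfolding noncrossing_rel_def by metis
  show "y \<in> {1..n}" if xy: "noncrossing_rel n w x y" "x \<noteq> y"
  proof -
    \<comment> \<open>Membership of the long cycle, which fixes all points outside
      \<open>{1..n}\<close>, isolates those points in the intersection.\<close>
    have "long_cycle n \<in> noncrossing_above n w"
      using long_cycle_permutes noncrossing_long_cycle[OF n] orbit_long_cycle_refines[OF n w]
      unfolding noncrossing_above_def by blast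
    then have y: "y \<in> orbit (long_cycle n) x" using xy(1) unfolding noncrossing_rel_def by blast
    have "x \<in> {1..n}"
    proof (rule ccontr)
      assume "x \<notin> {1..n}"
      then have "orbit (long_cycle n) x = {x}"
        unfolding orbit_eq_singleton_iff by (rule permutes_not_in[OF long_cycle_permutes])
      then show False using y xy(2) by simp
    qed
    then show ?thesis using permutes_orbit_subset[OF long_cycle_permutes] y by blast
  qed
next
  fix a b c d :: nat
  assume "a < b" "b < c" "c < d" "noncrossing_rel n w a c" "noncrossing_rel n w b d"
  then show "noncrossing_rel n w a b"
    unfolding noncrossing_rel_def
    using noncrossing_orbits_4[OF noncrossing_aboveD(4,2)] by meson
qed

lemma orbit_noncrossing_closure:
  assumes "n \<ge> 1" "w permutes {1..n}"
  shows "y \<in> orbit (noncrossing_closure n w) x \<longleftrightarrow> noncrossing_rel n w x y"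
  unfolding noncrossing_closure_def
  by (rule noncrossing_equiv.orbit_cyclic_succ[OF noncrossing_equiv_rel[OF assms]])

lemma noncrossing_closure_above:
  assumes "n \<ge> 1" "w permutes {1..n}"
  shows "noncrossing_closure n w \<in> noncrossing_above n w"
proof -
  note E = noncrossing_equiv_rel[OF assms]
  have "w x \<in> orbit (noncrossing_closure n w) x" for x
    unfolding orbit_noncrossing_closure[OF assms] noncrossing_rel_def
    using noncrossing_aboveD(3) by blast
  then show ?thesis
    using noncrossing_equiv.cyclic_succ_permutes[OF E] noncrossing_equiv.noncrossing_cyclic_succ[OF E]
    by (simp add: noncrossing_above_def noncrossing_closure_def)
qed

lemma noncrossing_closure_least:
  assumes "n \<ge> 1" "w permutes {1..n}" "u \<in> noncrossing_above n w"
  shows "noncrossing_closure n w x \<in> orbit u x"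
  using orbit.base[of "noncrossing_closure n w" x] assms(3)
  unfolding orbit_noncrossing_closure[OF assms(1,2)] noncrossing_rel_def by blast

text \<open>The upper bounds of the reflections below \<open>w\<close> are exactly
  \<open>noncrossing_above n w\<close>, and the closure is the least of them.\<close>

lemma pi_T_eq:
  assumes n: "n \<ge> 1" and w: "w permutes {1..n}"
  shows "pi_T n w (long_cycle n) = noncrossing_closure n w"
proof -
  let ?L = "NC n (long_cycle n)" and ?A = "{t \<in> transpositions n. abs_le n t w}"
  let ?p = "noncrossing_closure n w"
  have le: "le ?L = abs_le n" by (simp add: NC_def)
  note p = noncrossing_closure_above[OF n w]
  \<comment> \<open>\<open>Upper\<close> tests only those elements of \<open>?A\<close> that lie in
    the carrier.\<close>
  have A: "?A \<subseteq> carrier ?L"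
  proof
    fix t assume "t \<in> ?A"
    then obtain i j where "t = transpose i j" "i < j" "t \<in> transpositions n"
      by (auto simp: transpositions_def)
    then show "t \<in> carrier ?L"
      unfolding NC_carrier_iff[OF n] using noncrossing_transpose transpositions_permutes by blast
  qed
  have U: "Upper ?L ?A = noncrossing_above n w"
  proof
    show "Upper ?L ?A \<subseteq> noncrossing_above n w"
    proof
      fix u assume u: "u \<in> Upper ?L ?A"
      then have up: "u permutes {1..n}" "noncrossing u"
        using NC_carrier_iff[OF n] by (auto simp: Upper_def)
      have "w x \<in> orbit u x" for x
      proof (cases "w x = x")
        case True
        then show ?thesis
          using permutation_self_in_orbit[OF permutes_interval_permutation[OF up(1)]] by simp
      next
        case False
        note t = transposition_abs_le_apply[OF w False]
        then have "abs_le n (transpose x (w x)) u" using u A le by (auto simp: Upper_def)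
        moreover have "x \<in> {1..n}" "w x \<in> {1..n}"
          using False permutes_not_in[OF w] permutes_in_image[OF w] by metis+
        ultimately show ?thesis using abs_le_transposition_imp_orbit[OF up(1) _ _ t(1)] by blast
      qed
      then show "u \<in> noncrossing_above n w" using up by (simp add: noncrossing_above_def)
    qed
    show "noncrossing_above n w \<subseteq> Upper ?L ?A"
    proof
      fix u assume u: "u \<in> noncrossing_above n w"
      note up = noncrossing_aboveD[OF u]
      have "abs_le n t u" if t: "t \<in> ?A" for t
      proof -
        from t obtain i j where ij: "t = transpose i j" "1 \<le> i" "i < j" "j \<le> n"
          by (auto simp: transpositions_def)
        have "j \<in> orbit w i"
          using ij t by (intro abs_le_transposition_imp_orbit[OF w]) auto
        then have "j \<in> orbit u i" by (rule noncrossing_above_orbit[OF u])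
        then show ?thesis unfolding ij(1) using transposition_abs_le_iff[OF up(1,2) ij(2-4)] by blast
      qed
      moreover have "u \<in> carrier ?L" using NC_carrier_iff[OF n] up(1,2) by blast
      ultimately show "u \<in> Upper ?L ?A" using le by (auto simp: Upper_def)
    qed
  qed
  have sub: "noncrossing_above n w \<subseteq> carrier ?L"
    using NC_carrier_iff[OF n] noncrossing_aboveD by blast
  have least: "abs_le n ?p u" if "u \<in> noncrossing_above n w" for u
    by (rule abs_le_refines[OF noncrossing_aboveD(1,2)[OF p] noncrossing_aboveD(1,2)[OF that]])
      (rule noncrossing_closure_least[OF n w that])
  have "least ?L ?p (Upper ?L ?A)" unfolding least_def U le using sub p least by blast
  \<comment> \<open>The join is a choice among least upper bounds, so uniqueness is
    required.\<close>
  moreover have "q = ?p" if "least ?L q (Upper ?L ?A)" for q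
  proof -
    have q: "q \<in> noncrossing_above n w" "abs_le n q ?p"
      using that p unfolding least_def U le by blast+
    show ?thesis
      by (rule abs_le_antisym[OF noncrossing_aboveD(1)[OF q(1)] noncrossing_aboveD(1)[OF p] q(2) least[OF q(1)]])
  qed
  ultimately show ?thesis unfolding pi_T_def sup_def by (rule some_equality)
qed

text \<open>Otherwise \<open>j\<close> could be cut off from its cycle: the result is still
  noncrossing and still above \<open>w\<close>, since \<open>w\<close> moves no other point to
  \<open>j\<close>. This contradicts minimality.\<close>

lemma noncrossing_closure_fixed:
  assumes n: "n \<ge> 1" and w: "w permutes {1..n}" and j: "w j = j"
  shows "noncrossing_closure n w j = j"
proof (rule ccontr)
  let ?p = "noncrossing_closure n w"
  assume pj: "?p j \<noteq> j"
  note p = noncrossing_aboveD[OF noncrossing_closure_above[OF n w]]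
  define i where "i = inv ?p j"
  have pi: "?p i = j" unfolding i_def by (rule permutes_inverses(1)[OF p(1)])
  have jn: "j \<in> {1..n}" using pj permutes_not_in[OF p(1)] by blast
  then have i_n: "i \<in> {1..n}" unfolding i_def using permutes_in_image[OF permutes_inv[OF p(1)]] by blast
  define v where "v = ?p \<circ> transpose i j"
  have "j \<in> orbit ?p i" using orbit.base[of ?p i] pi by simp
  then have nv: "noncrossing v" unfolding v_def by (rule noncrossing_split[OF p(4,2)])
  have v: "v permutes {1..n}" unfolding v_def by (intro permutes_compose permutes_swap_id i_n jn p(1))
  note pv = permutes_interval_permutation[OF v]
  have "v j = j" by (simp add: v_def pi)
  then have vj: "orbit v j = {j}" by (simp only: orbit_eq_singleton_iff)
  have "w x \<in> orbit v x" for x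
  proof (cases "x = j")
    case True
    then show ?thesis using j vj by simp
  next
    case False
    then have "w x \<noteq> j" using j permutes_inj[OF w] by (metis injD)
    have "w x \<in> orbit (v \<circ> transpose i j) x" unfolding v_def comp_transpose_twice by (rule p(3))
    then have "w x \<in> orbit v x \<or> {x, w x} \<subseteq> orbit v i \<union> orbit v j"
      by (rule orbit_comp_transpose[OF pv])
    then show ?thesis
      using vj False \<open>w x \<noteq> j\<close> orbit_eq_orbit[OF pv, of x i] by auto
  qed
  then have "v \<in> noncrossing_above n w" using v nv by (simp add: noncrossing_above_def)
  from noncrossing_closure_least[OF n w this, of j] vj pj show False by simp
qed

section \<open>Counting antiexceedances\<close>

text \<open>The arc wraps around, so its complement is the interval from \<open>p j\<close> to
  \<open>j\<close>, which must contain the whole orbit.\<close>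

lemma noncrossing_descent:
  assumes "noncrossing p" "p j \<le> j" "y \<in> orbit p j"
  shows "p j \<le> y" "y \<le> j"
  using noncrossing_orbit_not_gap[OF assms(1,3)] assms(2) by (auto simp: gap_def)

text \<open>Each nontrivial cycle has exactly one descent, at its maximum.\<close>

lemma cyc_gt1_noncrossing:
  assumes p: "p permutes {1..n}" "noncrossing p"
  shows "cyc_gt1 n p = card {j \<in> {1..n}. p j < j}"
proof -
  note pp = permutes_interval_permutation[OF p(1)]
  have self: "x \<in> orbit p x" for x by (rule permutation_self_in_orbit[OF pp])
  have fin: "finite (orbit p x)" for x by (rule finite_orbit[OF self])
  have "bij_betw (orbit p) {j \<in> {1..n}. p j < j} {C \<in> orbit p ` {1..n}. card C > 1}"
    unfolding bij_betw_def
  proof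
    show "inj_on (orbit p) {j \<in> {1..n}. p j < j}"
    proof (rule inj_onI)
      fix i j assume ij: "i \<in> {j \<in> {1..n}. p j < j}" "j \<in> {j \<in> {1..n}. p j < j}" "orbit p i = orbit p j"
      then have "i \<in> orbit p j" "j \<in> orbit p i" using self by metis+
      then show "i = j"
        using noncrossing_descent(2)[OF p(2), of i j] noncrossing_descent(2)[OF p(2), of j i] ij by auto
    qed
    show "orbit p ` {j \<in> {1..n}. p j < j} = {C \<in> orbit p ` {1..n}. card C > 1}"
    proof (intro equalityI subsetI)
      fix C assume "C \<in> orbit p ` {j \<in> {1..n}. p j < j}"
      then obtain j where j: "j \<in> {1..n}" "p j < j" "C = orbit p j" by blast
      have "{j, p j} \<subseteq> orbit p j" using self orbit.base by auto
      then have "card {j, p j} \<le> card (orbit p j)" by (rule card_mono[OF fin])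
      then show "C \<in> {C \<in> orbit p ` {1..n}. card C > 1}" using j by auto
    next
      fix C assume "C \<in> {C \<in> orbit p ` {1..n}. card C > 1}"
      then obtain x where x: "x \<in> {1..n}" "C = orbit p x" "card C > 1" by auto
      define j where "j = Max C"
      have j: "j \<in> orbit p x"
        unfolding j_def x(2) using self[of x] by (intro Max_in fin) blast
      then have C: "C = orbit p j" using orbit_eq_orbit[OF pp] x(2) by simp
      have "p j \<in> C" unfolding C by (rule orbit.base)
      then have "p j \<le> j" unfolding j_def using Max_ge fin x(2) by blast
      moreover have "p j \<noteq> j"
      proof
        assume "p j = j"
        then have "C = {j}" unfolding C by (simp only: orbit_eq_singleton_iff)
        then show False using x(3) by simp
      qed
      moreover have "j \<in> {1..n}" using permutes_orbit_subset[OF p(1) x(1)] j by blast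
      ultimately show "C \<in> orbit p ` {j \<in> {1..n}. p j < j}" using C by auto
    qed
  qed
  from bij_betw_same_card[OF this] show ?thesis unfolding cyc_gt1_def by (rule sym)
qed

text \<open>Substitute \<open>i = w j\<close>. The identity as \<open>f\<close> serves
  \<open>w\<close> itself, the closure as \<open>f\<close> serves \<open>Pop_T\<close>.\<close>

lemma card_less_inv:
  assumes w: "w permutes {1..n}"
  shows "card {i \<in> {1..n}. i < f (inv w i)} = card {j \<in> {1..n}. w j < f j}"
proof -
  have "bij_betw w {j \<in> {1..n}. w j < f j} {i \<in> {1..n}. i < f (inv w i)}"
    using permutes_inverses[OF w] permutes_in_image[OF w]
      permutes_in_image[OF permutes_inv[OF w]]
    by (intro bij_betwI[where g = "inv w"]) auto
  from bij_betw_same_card[OF this] show ?thesis by (rule sym)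
qed

lemma aexc_eq:
  assumes "w permutes {1..n}"
  shows "aexc n w = card {j \<in> {1..n}. w j < j}"
  unfolding aexc_def by (rule card_less_inv[OF assms])

lemma aexc_Pop_T:
  assumes n: "n \<ge> 1" and w: "w permutes {1..n}"
  shows "aexc n w = aexc n (Pop_T n w (long_cycle n)) + cyc_gt1 n (pi_T n w (long_cycle n))"
proof -
  let ?p = "noncrossing_closure n w"
  note p = noncrossing_aboveD[OF noncrossing_closure_above[OF n w]]
  have "inv (w \<circ> inv ?p) = ?p \<circ> inv w"
    using permutes_bij[OF p(1)] permutes_bij[OF w]
    by (simp add: o_inv_distrib bij_imp_bij_inv inv_inv_eq)
  then have pop: "aexc n (Pop_T n w (long_cycle n)) = card {j \<in> {1..n}. w j < ?p j}"
    unfolding aexc_def Pop_T_def pi_T_eq[OF n w] using card_less_inv[OF w, of ?p] by simp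
  have iff: "w j < j \<longleftrightarrow> w j < ?p j \<or> ?p j < j" for j
  proof -
    \<comment> \<open>Rules out a point fixed by \<open>w\<close> but moved by \<open>?p\<close>,
      where the equivalence could fail.\<close>
    have "w j \<noteq> j \<or> ?p j = j" using noncrossing_closure_fixed[OF n w] by blast
    moreover have "\<not> gap j (?p j) (w j)" by (rule noncrossing_orbit_not_gap[OF p(2,3)])
    ultimately show ?thesis by (auto simp: gap_def split: if_splits)
  qed
  \<comment> \<open>At a descent, \<open>?p j\<close> is the minimum of the block, and
    \<open>w j\<close> lies in that block.\<close>
  have disj: "\<not> (w j < ?p j \<and> ?p j < j)" for j
    using noncrossing_descent(1)[OF p(2) _ p(3)] by (metis less_imp_le not_less)
  have "{j \<in> {1..n}. w j < j} = {j \<in> {1..n}. w j < ?p j} \<union> {j \<in> {1..n}. ?p j < j}"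
    using iff by blast
  moreover have "card ({j \<in> {1..n}. w j < ?p j} \<union> {j \<in> {1..n}. ?p j < j}) =
      card {j \<in> {1..n}. w j < ?p j} + card {j \<in> {1..n}. ?p j < j}"
    using disj by (intro card_Un_disjoint) auto
  ultimately show ?thesis
    by (simp only: aexc_eq[OF w] pop pi_T_eq[OF n w] cyc_gt1_noncrossing[OF p(1,2)])
qed

section \<open>The inverse long cycle as the unique maximum of antiexceedances\<close>

lemma aexc_inv_long_cycle:
  assumes "n \<ge> 1"
  shows "aexc n (inv (long_cycle n)) = n - 1"
proof -
  have "{i \<in> {1..n}. i < long_cycle n i} = {1..<n}"
    using assms by (auto simp: long_cycle_apply)
  then show ?thesis
    by (simp add: aexc_def inv_inv_eq permutes_bij[OF long_cycle_permutes] del: One_nat_def)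
qed

lemma permutes_increasing_eq_long_cycle:
  assumes n: "n \<ge> 1" and f: "f permutes {1..n}" and lt: "\<And>i. 1 \<le> i \<Longrightarrow> i < n \<Longrightarrow> i < f i"
  shows "f = long_cycle n"
proof -
  note inj = permutes_inj[OF f, THEN injD]
  have step: "f i = i + 1" if "1 \<le> i" "i < n" for i
    using that
  proof (induction "n - i" arbitrary: i rule: less_induct)
    case less
    show ?case
    proof (rule ccontr)
      assume ne: "f i \<noteq> i + 1"
      have "f i \<in> {1..n}" using permutes_in_image[OF f] less.prems by auto
      \<comment> \<open>By downward induction \<open>f i - 1\<close> is already sent to
        \<open>f i\<close>, the value at \<open>i\<close>, against injectivity.\<close>
      then have k: "i < f i - 1" "f i - 1 < n" using lt[OF less.prems] ne by auto
      then have "f (f i - 1) = f i" using less.hyps[of "f i - 1"] less.prems by auto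
      then show False using inj[of "f i - 1" i] k by simp
    qed
  qed
  have "1 \<in> f ` {1..n}" using permutes_image[OF f] n by simp
  then obtain k where k: "k \<in> {1..n}" "f k = 1" by force
  then have "k = n" using step[of k] by (cases "k < n") auto
  show ?thesis
  proof
    fix i
    consider "1 \<le> i" "i < n" | "i = n" | "i \<notin> {1..n}" by fastforce
    then show "f i = long_cycle n i"
      using step[of i] k \<open>k = n\<close> permutes_not_in[OF f, of i] n
      by cases (auto simp: long_cycle_apply)
  qed
qed

lemma aexc_le:
  assumes n: "n \<ge> 1" and w: "w permutes {1..n}" and ne: "w \<noteq> inv (long_cycle n)"
  shows "aexc n w + 2 \<le> n"
proof -
  let ?f = "inv w" and ?A = "{i \<in> {1..n}. i < inv w i}"
  have f: "?f permutes {1..n}" by (rule permutes_inv[OF w])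
  have le: "?f i \<le> n" if "i \<in> {1..n}" for i using permutes_in_image[OF f, of i] that by simp
  have "?f \<noteq> long_cycle n" using ne inv_inv_eq[OF permutes_bij[OF w]] by metis
  then obtain i where i: "1 \<le> i" "i < n" "\<not> i < ?f i"
    using permutes_increasing_eq_long_cycle[OF n f] by blast
  \<comment> \<open>Besides \<open>i\<close>, the point \<open>n\<close> is missing, as no value
    exceeds \<open>n\<close>.\<close>
  have "?A \<subseteq> {1..n} - {i, n}" using i le by force
  then have "card ?A \<le> card ({1..n} - {i, n})" by (intro card_mono) auto
  also have "\<dots> = n - 2" using i by (subst card_Diff_subset) auto
  finally show ?thesis using i by (simp add: aexc_def)
qed

theorem theorem5p2:
  fixes n :: nat and c :: "nat \<Rightarrow> nat"
  assumes "n \<ge> 1"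
    and "c = long_cycle n"
  shows "aexc n (inv c) = n - 1
    \<and> (\<forall>w. w permutes {1..n} \<and> w \<noteq> inv c \<longrightarrow> int (aexc n w) \<le> int n - 2)
    \<and> (\<forall>w. w permutes {1..n} \<longrightarrow>
          int (aexc n (Pop_T n w c)) = int (aexc n w) - int (cyc_gt1 n (pi_T n w c)))"
  unfolding assms(2)
proof (intro conjI allI impI)
  show "aexc n (inv (long_cycle n)) = n - 1" by (rule aexc_inv_long_cycle[OF assms(1)])
next
  fix w assume "w permutes {1..n} \<and> w \<noteq> inv (long_cycle n)"
  then have "aexc n w + 2 \<le> n" using aexc_le[OF assms(1)] by blast
  then show "int (aexc n w) \<le> int n - 2" by linarith
next
  fix w assume "w permutes {1..n}"
  from aexc_Pop_T[OF assms(1) this]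
  show "int (aexc n (Pop_T n w (long_cycle n))) =
      int (aexc n w) - int (cyc_gt1 n (pi_T n w (long_cycle n)))" by linarith
qed

end
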